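(* Let $K$ be a field, $R = K[x_1,\ldots,x_n]$, and let $I \subseteq R$ be a monomial ideal with $\operatorname{ht} I \geq 2$. Let $\widehat I$ be the LCM-dual of $I$. Then the LCM-dual of $\widehat I$ is $I$, that is, $\widehat{\widehat{I}} = I$.
   Context: For a monomial ideal $I \subseteq R = K[x_1,\ldots,x_n]$ with (unique) minimal set of monomial generators $\{f_1,\ldots,f_\nu\}$, put $m_I = \operatorname{lcm}(f_1,\ldots,f_\nu)$. The LCM-dual of $I$ is the monomial ideal $\widehat I$ generated by the monomials $\widehat{f_i} = m_I/f_i$, $i=1,\ldots,\nu$. $\operatorname{ht} I$ denotes the height of $I$. *)

theory Defs
  imports
    "HOL-Algebra.Algebraic_Closure_Type"
    "HOL-Library.Poly_Mapping"
    "HOL-Library.Extended_Nat"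
begin

section \<open>Height of an ideal\<close>

text \<open>A chain of primes of length \<open>k\<close> below \<open>P\<close> is \<open>C 0 \<subset> \<dots> \<subset> C k = P\<close>.\<close>

definition prime_height :: "('a, 'm) ring_scheme \<Rightarrow> 'a set \<Rightarrow> enat" where
  "prime_height R P =
     Sup {enat k | k. \<exists>C :: nat \<Rightarrow> 'a set.
       (\<forall>i\<le>k. primeideal (C i) R) \<and> (\<forall>i<k. C i \<subset> C (Suc i)) \<and> C k = P}"

text \<open>The infimum over the empty set is \<open>\<infinity>\<close>, so the unit ideal has height \<open>\<infinity>\<close>.\<close>

definition ideal_height :: "('a, 'm) ring_scheme \<Rightarrow> 'a set \<Rightarrow> enat" where
  "ideal_height R I = Inf {prime_height R P | P. primeideal P R \<and> I \<subseteq> P}"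


section \<open>Monomial ideals\<close>

text \<open>
  For a finite type \<open>'n\<close> of variables, \<open>('n, 'k) mpoly\<close> is the polynomial ring over \<open>'k\<close> in
  \<open>CARD('n)\<close> variables: finitely supported functions from exponent vectors to coefficients, with
  convolution as multiplication. Monomials (with coefficient 1) are represented by their exponent
  vectors.
\<close>

type_synonym 'n expo = "'n \<Rightarrow>\<^sub>0 nat"
type_synonym ('n, 'k) mpoly = "'n expo \<Rightarrow>\<^sub>0 'k"

abbreviation mpoly_ring :: "('n::finite, 'k::{Fields.field}) mpoly ring" where
  "mpoly_ring \<equiv> ring_of_type_algebra"

definition mono_of :: "'n::finite expo \<Rightarrow> ('n, 'k::{Fields.field}) mpoly" where
  "mono_of a = Poly_Mapping.single a 1"

definition mono_ideal :: "'n::finite expo set \<Rightarrow> ('n, 'k::{Fields.field}) mpoly set" where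
  "mono_ideal F = genideal mpoly_ring (mono_of ` F)"

definition monomial_ideal :: "('n::finite, 'k::{Fields.field}) mpoly set \<Rightarrow> bool" where
  "monomial_ideal I \<longleftrightarrow> (\<exists>F. I = mono_ideal F)"

definition min_mono_gens :: "('n::finite, 'k::{Fields.field}) mpoly set \<Rightarrow> 'n expo set" where
  "min_mono_gens I = (THE F. mono_ideal F = I \<and> (\<forall>G. G \<subset> F \<longrightarrow> mono_ideal G \<noteq> I))"


section \<open>The LCM-dual\<close>

text \<open>
  The lcm of a finite set of monomials has as exponents the maxima of the exponents; the supremum of
  the empty set of natural numbers is 0, so the lcm of no monomials is 1.
\<close>

definition lcm_expo :: "'n::finite expo set \<Rightarrow> 'n expo" where
  "lcm_expo F = Abs_poly_mapping (\<lambda>i. Sup ((\<lambda>f. Poly_Mapping.lookup f i) ` F))"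

lemma lookup_lcm_expo:
  "Poly_Mapping.lookup (lcm_expo F) i = Sup ((\<lambda>f. Poly_Mapping.lookup f i) ` F)"
  unfolding lcm_expo_def by (subst Abs_poly_mapping_inverse) auto

lemma mono_of_mult: "mono_of (a + b) = mono_of a * mono_of b"
  by (simp add: mono_of_def mult_single)

lemma mono_of_dvd_iff:
  "mono_of a dvd (mono_of b :: ('n::finite, 'k::{Fields.field}) mpoly) \<longleftrightarrow>
     (\<forall>i. Poly_Mapping.lookup a i \<le> Poly_Mapping.lookup b i)"
proof
  assume "mono_of a dvd (mono_of b :: ('n, 'k) mpoly)"
  then obtain q :: "('n, 'k) mpoly" where q: "mono_of b = mono_of a * q"
    by (elim dvdE)
  have "b \<in> Poly_Mapping.keys (mono_of b :: ('n, 'k) mpoly)"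
    by (simp add: mono_of_def)
  then have "b \<in> Poly_Mapping.keys (mono_of a * q)"
    using q by simp
  then obtain c where "b = a + c"
    using keys_mult[of "mono_of a" q] by (auto simp: mono_of_def)
  then show "\<forall>i. Poly_Mapping.lookup a i \<le> Poly_Mapping.lookup b i"
    by (simp add: lookup_add)
next
  assume "\<forall>i. Poly_Mapping.lookup a i \<le> Poly_Mapping.lookup b i"
  then have "b = a + (b - a)"
    by (intro poly_mapping_eqI) (simp add: lookup_add lookup_minus)
  then show "mono_of a dvd (mono_of b :: ('n, 'k) mpoly)"
    by (metis dvd_triv_left mono_of_mult)
qed

lemma lcm_expo_is_lcm:
  assumes "finite F"
  shows "mono_of (lcm_expo F) dvd (mono_of b :: ('n::finite, 'k::{Fields.field}) mpoly) \<longleftrightarrow>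
           (\<forall>f\<in>F. mono_of f dvd (mono_of b :: ('n, 'k) mpoly))"
proof (cases "F = {}")
  case True
  then show ?thesis by (simp add: mono_of_dvd_iff lookup_lcm_expo)
next
  case False
  then show ?thesis
    using assms by (auto simp: mono_of_dvd_iff lookup_lcm_expo Sup_nat_def)
qed

text \<open>
  Since every \<open>f \<in> min_mono_gens I\<close> divides the lcm, the pointwise truncated difference of exponent
  vectors is the exponent vector of the quotient \<open>m\<^sub>I / f\<close>.
\<close>

definition lcm_dual ::
  "('n::finite, 'k::{Fields.field}) mpoly set \<Rightarrow> ('n, 'k) mpoly set" where
  "lcm_dual I =
     mono_ideal ((\<lambda>f. lcm_expo (min_mono_gens I) - f) ` min_mono_gens I)"

end

theory Submission
  imports Defs
begin

text \<open>
  Write \<open>F\<close> for the set of exponent vectors of the minimal generators of \<open>I\<close>. It is a finite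
  antichain for divisibility, and conversely every antichain \<open>F\<close> is the minimal generating set of
  the ideal that it generates (\<open>min_mono_gens_antichain\<close>). With \<open>m = lcm F\<close>, the map \<open>f \<mapsto> m - f\<close>
  reverses divisibility on \<open>F\<close>, so the dual generators form an antichain again and are the minimal
  generators of the dual. In the \<open>i\<close>-th coordinate their lcm is the maximum of \<open>m\<^sub>i - f\<^sub>i\<close>, that is,
  \<open>m\<^sub>i\<close> minus the minimum of the \<open>f\<^sub>i\<close>. Hence, if the gcd of \<open>F\<close> is \<open>1\<close>, the dual has the same lcm
  \<open>m\<close> as \<open>I\<close>, and dualizing twice sends \<open>f\<close> to \<open>m - (m - f) = f\<close>.

  The height enters only through the gcd. If a variable \<open>x\<^sub>i\<close> divides all generators, then \<open>I\<close> lies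
  in the ideal \<open>(x\<^sub>i)\<close>, which is prime of height at most \<open>1\<close> (\<open>primeideal_variable\<close>,
  \<open>prime_height_variable_le_1\<close>); so height at least \<open>2\<close> forces the gcd to be \<open>1\<close>
  (\<open>ex_generator_without_variable\<close>). This also excludes the zero ideal, for which \<open>F\<close> is empty.
\<close>

section \<open>Divisibility of exponent vectors and Dickson's lemma\<close>

definition expo_dvd :: "'n expo \<Rightarrow> 'n expo \<Rightarrow> bool" (infix "\<preceq>" 50) where
  "a \<preceq> b \<longleftrightarrow> (\<forall>i. Poly_Mapping.lookup a i \<le> Poly_Mapping.lookup b i)"

definition antichain :: "'n expo set \<Rightarrow> bool" where
  "antichain F \<longleftrightarrow> (\<forall>f\<in>F. \<forall>g\<in>F. f \<preceq> g \<longrightarrow> f = g)"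

lemma expo_dvd_refl [simp]: "a \<preceq> a"
  by (simp add: expo_dvd_def)

lemma expo_dvd_trans: "a \<preceq> b \<Longrightarrow> b \<preceq> c \<Longrightarrow> a \<preceq> c"
  unfolding expo_dvd_def by (meson le_trans)

lemma expo_dvd_antisym: "a \<preceq> b \<Longrightarrow> b \<preceq> a \<Longrightarrow> a = b"
  by (intro poly_mapping_eqI) (simp add: expo_dvd_def le_antisym)

lemma expo_dvd_add: "a \<preceq> b + a"
  by (simp add: expo_dvd_def lookup_add)

lemma expo_dvd_diff_add: "a \<preceq> b \<Longrightarrow> b - a + a = b"
  by (intro poly_mapping_eqI) (simp add: expo_dvd_def lookup_add lookup_minus)

lemma nat_seq_incseq_subseq:
  fixes s :: "nat \<Rightarrow> nat"
  shows "\<exists>r. strict_mono r \<and> incseq (s \<circ> r)"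
proof -
  obtain r where r: "strict_mono r" and mono: "monoseq (\<lambda>n. s (r n))"
    using seq_monosub by blast
  show ?thesis
  proof (cases "incseq (\<lambda>n. s (r n))")
    case True
    with r show ?thesis by (auto simp: o_def)
  next
    case False
    with mono have dec: "decseq (\<lambda>n. s (r n))"
      by (simp add: monoseq_iff)
    \<comment> \<open>A decreasing sequence of natural numbers is constant from the place of its minimum on.\<close>
    define N where "N = (ARG_MIN (\<lambda>n. s (r n)) n. True)"
    have min: "s (r N) \<le> s (r n)" for n
      unfolding N_def by (rule arg_min_nat_le) simp
    have "s (r (N + n)) = s (r N)" for n
      using dec min[of "N + n"] by (auto simp: decseq_def intro: antisym)
    moreover have "strict_mono (\<lambda>n. r (N + n))"
      using r by (auto simp: strict_mono_def)
    ultimately show ?thesis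
      by (intro exI[of _ "\<lambda>n. r (N + n)"]) (auto simp: incseq_def)
  qed
qed

lemma expo_seq_incseq_subseq:
  fixes s :: "nat \<Rightarrow> 'n expo"
  assumes "finite S"
  shows "\<exists>r. strict_mono r \<and> (\<forall>i\<in>S. incseq (\<lambda>n. Poly_Mapping.lookup (s (r n)) i))"
  using assms
proof induction
  case empty
  show ?case by (auto intro: exI[of _ id] simp: strict_mono_def)
next
  case (insert j S)
  then obtain r where r: "strict_mono r"
    "\<And>i. i \<in> S \<Longrightarrow> incseq (\<lambda>n. Poly_Mapping.lookup (s (r n)) i)" by blast
  obtain t where t: "strict_mono t" "incseq ((\<lambda>n. Poly_Mapping.lookup (s (r n)) j) \<circ> t)"
    using nat_seq_incseq_subseq by blast
  have "incseq (\<lambda>n. Poly_Mapping.lookup (s (r (t n))) i)" if "i \<in> insert j S" for i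
  proof (cases "i = j")
    case True
    then show ?thesis using t(2) by (simp add: o_def)
  next
    case False
    then have "incseq (\<lambda>n. Poly_Mapping.lookup (s (r n)) i)" using that r(2) by blast
    then show ?thesis
      using strict_mono_less_eq[OF t(1)] by (auto simp: incseq_def)
  qed
  then show ?case
    using strict_mono_o[OF r(1) t(1)] by (intro exI[of _ "\<lambda>n. r (t n)"]) (auto simp: o_def)
qed

text \<open>
  Dickson's lemma: a sequence of distinct elements would have a subsequence that increases in each
  of the finitely many coordinates, hence two comparable elements.
\<close>

lemma finite_antichain:
  fixes F :: "'n::finite expo set"
  assumes "antichain F"
  shows "finite F"
proof (rule ccontr)
  assume "infinite F"
  then obtain s :: "nat \<Rightarrow> 'n expo" where s: "inj s" "range s \<subseteq> F"
    using infinite_countable_subset by blast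
  obtain r where r: "strict_mono r" "\<And>i. incseq (\<lambda>n. Poly_Mapping.lookup (s (r n)) i)"
    using expo_seq_incseq_subseq[of UNIV s] by auto
  have "s (r 0) \<preceq> s (r 1)"
    using r(2) by (simp add: expo_dvd_def incseq_def)
  then have "s (r 0) = s (r 1)"
    using assms s(2) by (meson antichain_def rangeI subsetD)
  then have "r 0 = r 1"
    using s(1) by (simp add: inj_eq)
  then show False
    using strict_mono_eq[OF r(1)] by simp
qed

lemma ex_minimal_divisor:
  fixes b :: "'n::finite expo"
  assumes "b \<in> E"
  shows "\<exists>a\<in>E. a \<preceq> b \<and> (\<forall>c\<in>E. c \<preceq> a \<longrightarrow> c = a)"
  using assms
proof (induction "\<Sum>i\<in>UNIV. Poly_Mapping.lookup b i" arbitrary: b rule: less_induct)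
  case less
  show ?case
  proof (cases "\<forall>c\<in>E. c \<preceq> b \<longrightarrow> c = b")
    case True
    with less.prems show ?thesis using expo_dvd_refl by blast
  next
    case False
    then obtain c where c: "c \<in> E" "c \<preceq> b" "c \<noteq> b" by blast
    then have "\<exists>i. Poly_Mapping.lookup c i < Poly_Mapping.lookup b i"
      by (metis expo_dvd_def order_le_less poly_mapping_eqI)
    then have "(\<Sum>i\<in>UNIV. Poly_Mapping.lookup c i) < (\<Sum>i\<in>UNIV. Poly_Mapping.lookup b i)"
      using c(2) by (intro sum_strict_mono_ex1) (auto simp: expo_dvd_def)
    from less.hyps[OF this c(1)] c(2) show ?thesis
      using expo_dvd_trans by blast
  qed
qed


section \<open>Ideals of a type-class ring\<close>

lemma ideal_ring_of_type_algebra_iff: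
  fixes I :: "'a::comm_ring_1 set"
  shows "ideal I ring_of_type_algebra \<longleftrightarrow>
    0 \<in> I \<and> (\<forall>a\<in>I. \<forall>b\<in>I. a + b \<in> I) \<and> (\<forall>a\<in>I. \<forall>x. x * a \<in> I)" (is "_ \<longleftrightarrow> ?closed")
proof
  assume "ideal I ring_of_type_algebra"
  then interpret ideal I "ring_of_type_algebra :: 'a ring" .
  show ?closed
    using additive_subgroup.zero_closed[OF is_additive_subgroup]
      additive_subgroup.a_closed[OF is_additive_subgroup] I_l_closed
    by (auto simp: ring_of_type_algebra_def)
next
  assume closed: ?closed
  interpret cring "ring_of_type_algebra :: 'a ring" by (rule cring_from_type_algebra)
  have "- a \<in> I" if "a \<in> I" for a
    using closed that by (metis mult_minus1)
  moreover have "\<ominus>\<^bsub>ring_of_type_algebra\<^esub> a = - a" for a :: 'a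
    using minus_equality[of "- a" a]
    by (simp add: ring_of_type_algebra_def)
  ultimately have "subgroup I (add_monoid ring_of_type_algebra)"
    using closed by (intro add.subgroupI) (auto simp: ring_of_type_algebra_def)
  then show "ideal I ring_of_type_algebra"
    using closed by (intro idealI ring_axioms) (auto simp: ring_of_type_algebra_def mult.commute)
qed

lemma primeideal_ring_of_type_algebra_iff:
  fixes P :: "'a::comm_ring_1 set"
  shows "primeideal P ring_of_type_algebra \<longleftrightarrow>
    ideal P ring_of_type_algebra \<and> P \<noteq> UNIV \<and> (\<forall>a b. a * b \<in> P \<longrightarrow> a \<in> P \<or> b \<in> P)"
  using cring_from_type_algebra[where 'a = 'a]
  by (auto simp: primeideal_def primeideal_axioms_def ring_of_type_algebra_def)

lemma ideal_ring_of_type_algebra_sum: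
  fixes I :: "'a::comm_ring_1 set"
  assumes "ideal I ring_of_type_algebra" "\<And>x. x \<in> A \<Longrightarrow> f x \<in> I"
  shows "(\<Sum>x\<in>A. f x) \<in> I"
  using assms by (induction A rule: infinite_finite_induct) (auto simp: ideal_ring_of_type_algebra_iff)


section \<open>Monomial ideals and their minimal generators\<close>

lemma sum_single_keys: "(\<Sum>b\<in>Poly_Mapping.keys p. Poly_Mapping.single b (Poly_Mapping.lookup p b)) = p"
proof (rule poly_mapping_eqI)
  fix k
  have "(\<Sum>b\<in>Poly_Mapping.keys p. Poly_Mapping.lookup p b when b = k) = Poly_Mapping.lookup p k"
    by (cases "k \<in> Poly_Mapping.keys p") (auto simp: when_def sum.delta in_keys_iff)
  then show "Poly_Mapping.lookup (\<Sum>b\<in>Poly_Mapping.keys p.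
      Poly_Mapping.single b (Poly_Mapping.lookup p b)) k = Poly_Mapping.lookup p k"
    by (simp add: lookup_sum lookup_single)
qed

lemma ideal_mono_ideal: "ideal (mono_ideal F) mpoly_ring"
  unfolding mono_ideal_def
  by (rule ring.genideal_ideal[OF ring_from_type_algebra]) (simp add: ring_of_type_algebra_def)

lemma mono_ideal_mult: "p \<in> mono_ideal F \<Longrightarrow> x * p \<in> mono_ideal F"
  by (simp add: ideal_mono_ideal[unfolded ideal_ring_of_type_algebra_iff])

lemma mono_of_in_mono_ideal: "f \<in> F \<Longrightarrow> mono_of f \<in> mono_ideal F"
  unfolding mono_ideal_def
  using ring.genideal_self[OF ring_from_type_algebra, of "mono_of ` F"]
  by (auto simp: ring_of_type_algebra_def)

text \<open>
  Membership in a monomial ideal is decided term by term. The polynomials all of whose terms are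
  divisible by a generator form an ideal, which gives one inclusion; each such term is a multiple of
  a generator, which gives the other.
\<close>

lemma mono_ideal_eq:
  "(mono_ideal F :: ('n::finite, 'k::{Fields.field}) mpoly set) =
     {p. \<forall>b\<in>Poly_Mapping.keys p. \<exists>f\<in>F. f \<preceq> b}" (is "_ = ?J")
proof
  have add: "p + q \<in> ?J" if "p \<in> ?J" "q \<in> ?J" for p q
    using that Poly_Mapping.keys_add[of p q] by blast
  have mult: "x * p \<in> ?J" if "p \<in> ?J" for x p
  proof -
    have "\<exists>f\<in>F. f \<preceq> b" if "b \<in> Poly_Mapping.keys (x * p)" for b
    proof -
      from that obtain a c where "b = a + c" "c \<in> Poly_Mapping.keys p"
        using keys_mult[of x p] by blast
      with \<open>p \<in> ?J\<close> show ?thesis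
        using expo_dvd_trans expo_dvd_add by blast
    qed
    then show ?thesis by blast
  qed
  have "ideal ?J mpoly_ring"
    unfolding ideal_ring_of_type_algebra_iff
    by (intro conjI ballI allI add mult) (simp, assumption+)
  moreover have "mono_of ` F \<subseteq> ?J"
    by (simp add: mono_of_def image_subset_iff) (blast intro: expo_dvd_refl)
  ultimately show "mono_ideal F \<subseteq> ?J"
    unfolding mono_ideal_def by (rule ring.genideal_minimal[OF ring_from_type_algebra])
next
  show "?J \<subseteq> mono_ideal F"
  proof
    fix p :: "('n, 'k) mpoly" assume p: "p \<in> ?J"
    have "Poly_Mapping.single b (Poly_Mapping.lookup p b) \<in> mono_ideal F"
      if b: "b \<in> Poly_Mapping.keys p" for b
    proof -
      from p b obtain f where f: "f \<in> F" "f \<preceq> b" by blast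
      have "Poly_Mapping.single b (Poly_Mapping.lookup p b) =
          Poly_Mapping.single (b - f) (Poly_Mapping.lookup p b) * mono_of f"
        using f(2) by (simp add: mono_of_def mult_single expo_dvd_diff_add)
      then show ?thesis
        using mono_ideal_mult mono_of_in_mono_ideal[OF f(1)] by metis
    qed
    then show "p \<in> mono_ideal F"
      using ideal_ring_of_type_algebra_sum[OF ideal_mono_ideal] sum_single_keys[of p] by metis
  qed
qed

lemma mono_of_in_mono_ideal_iff:
  "(mono_of b :: ('n::finite, 'k::{Fields.field}) mpoly) \<in> mono_ideal F \<longleftrightarrow> (\<exists>f\<in>F. f \<preceq> b)"
  by (simp add: mono_ideal_eq mono_of_def)

text \<open>
  An antichain is contained in every monomial generating set of its ideal: a generator dividing
  \<open>f \<in> F\<close> is itself a multiple of some element of \<open>F\<close>, and this element can only be \<open>f\<close>.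
\<close>

lemma antichain_subset_generators:
  assumes "antichain F"
    and eq: "(mono_ideal G :: ('n::finite, 'k::{Fields.field}) mpoly set) = mono_ideal F"
  shows "F \<subseteq> G"
proof
  fix f assume f: "f \<in> F"
  then have "mono_of f \<in> (mono_ideal G :: ('n, 'k) mpoly set)"
    unfolding eq by (rule mono_of_in_mono_ideal)
  then obtain g where g: "g \<in> G" "g \<preceq> f"
    by (auto simp: mono_of_in_mono_ideal_iff)
  then have "mono_of g \<in> (mono_ideal F :: ('n, 'k) mpoly set)"
    unfolding eq[symmetric] by (intro mono_of_in_mono_ideal)
  then obtain f' where f': "f' \<in> F" "f' \<preceq> g"
    by (auto simp: mono_of_in_mono_ideal_iff)
  then have "f' = f"
    using assms(1) f expo_dvd_trans[OF f'(2) g(2)] by (simp add: antichain_def)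
  then show "f \<in> G"
    using g f'(2) expo_dvd_antisym by blast
qed

lemma min_mono_gens_antichain:
  assumes "antichain F"
  shows "min_mono_gens (mono_ideal F :: ('n::finite, 'k::{Fields.field}) mpoly set) = F"
  unfolding min_mono_gens_def
proof (rule the_equality)
  show "(mono_ideal F :: ('n, 'k) mpoly set) = mono_ideal F \<and>
      (\<forall>G. G \<subset> F \<longrightarrow> mono_ideal G \<noteq> (mono_ideal F :: ('n, 'k) mpoly set))"
    using antichain_subset_generators[OF assms] by blast
next
  fix G
  assume "mono_ideal G = (mono_ideal F :: ('n, 'k) mpoly set) \<and>
      (\<forall>H. H \<subset> G \<longrightarrow> mono_ideal H \<noteq> (mono_ideal F :: ('n, 'k) mpoly set))"
  then show "G = F"
    using antichain_subset_generators[OF assms] by blast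
qed

text \<open>
  The divisibility-minimal elements of any monomial generating set still generate, since each of
  its elements has a minimal divisor in the set.
\<close>

lemma monomial_ideal_antichain:
  fixes I :: "('n::finite, 'k::{Fields.field}) mpoly set"
  assumes "monomial_ideal I"
  obtains F where "antichain F" "I = mono_ideal F"
proof -
  from assms obtain E where E: "I = mono_ideal E"
    by (auto simp: monomial_ideal_def)
  define F where "F = {a\<in>E. \<forall>c\<in>E. c \<preceq> a \<longrightarrow> c = a}"
  have "(\<exists>f\<in>F. f \<preceq> b) \<longleftrightarrow> (\<exists>f\<in>E. f \<preceq> b)" for b
    using ex_minimal_divisor[of _ E] expo_dvd_trans unfolding F_def by blast
  then have "I = mono_ideal F"
    by (simp add: E mono_ideal_eq)
  moreover have "antichain F"
    by (auto simp: F_def antichain_def)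
  ultimately show ?thesis by (rule that[rotated])
qed


section \<open>The prime ideal generated by a variable\<close>

text \<open>
  If two sets of exponents contain a pair whose sum is attained only once, then nothing can cancel
  the product of the corresponding terms in a product of polynomials. The pair is found by passing,
  one coordinate after the other, to the subsets on which this coordinate is largest; the invariant
  is that a sum of elements of the subsets does not arise from elements outside of them.
\<close>

lemma unique_sum_coordinates:
  fixes A B :: "'n expo set"
  assumes "finite S" "finite A" "A \<noteq> {}" "finite B" "B \<noteq> {}"
  shows "\<exists>A' B'. A' \<subseteq> A \<and> A' \<noteq> {} \<and> B' \<subseteq> B \<and> B' \<noteq> {} \<and>
    (\<forall>i\<in>S. \<forall>a\<in>A'. \<forall>a'\<in>A'. Poly_Mapping.lookup a i = Poly_Mapping.lookup a' i) \<and>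
    (\<forall>i\<in>S. \<forall>b\<in>B'. \<forall>b'\<in>B'. Poly_Mapping.lookup b i = Poly_Mapping.lookup b' i) \<and>
    (\<forall>a\<in>A. \<forall>b\<in>B. \<forall>a'\<in>A'. \<forall>b'\<in>B'. a + b = a' + b' \<longrightarrow> a \<in> A' \<and> b \<in> B')"
  using assms(1)
proof induction
  case empty
  show ?case by (rule exI[of _ A], rule exI[of _ B]) (simp add: assms)
next
  case (insert j S)
  from insert.IH obtain A' B' where sub: "A' \<subseteq> A" "A' \<noteq> {}" "B' \<subseteq> B" "B' \<noteq> {}"
    and constA: "\<forall>i\<in>S. \<forall>a\<in>A'. \<forall>a'\<in>A'. Poly_Mapping.lookup a i = Poly_Mapping.lookup a' i"
    and constB: "\<forall>i\<in>S. \<forall>b\<in>B'. \<forall>b'\<in>B'. Poly_Mapping.lookup b i = Poly_Mapping.lookup b' i"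
    and sums: "\<forall>a\<in>A. \<forall>b\<in>B. \<forall>a'\<in>A'. \<forall>b'\<in>B'. a + b = a' + b' \<longrightarrow> a \<in> A' \<and> b \<in> B'"
    by (elim exE conjE)
  define top where "top D = {x\<in>D. \<forall>y\<in>D. Poly_Mapping.lookup y j \<le> Poly_Mapping.lookup x j}"
    for D :: "'n expo set"
  have top_nonempty: "top D \<noteq> {}" if "finite D" "D \<noteq> {}" for D
  proof -
    have "Max ((\<lambda>x. Poly_Mapping.lookup x j) ` D) \<in> (\<lambda>x. Poly_Mapping.lookup x j) ` D"
      using that by (intro Max_in) auto
    then obtain x where "x \<in> D" "Poly_Mapping.lookup x j = Max ((\<lambda>x. Poly_Mapping.lookup x j) ` D)"
      by auto
    then show ?thesis using that(1) by (auto simp: top_def)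
  qed
  have nonempty: "top A' \<noteq> {}" "top B' \<noteq> {}"
    using sub(2,4) finite_subset[OF sub(1) assms(2)] finite_subset[OF sub(3) assms(4)]
    by (auto dest: top_nonempty)
  show ?case
  proof (rule exI[of _ "top A'"], rule exI[of _ "top B'"], intro conjI ballI impI)
    show "top A' \<subseteq> A" "top B' \<subseteq> B"
      using sub by (auto simp: top_def)
  next
    show "top A' \<noteq> {}" "top B' \<noteq> {}"
      using nonempty .
  next
    show "Poly_Mapping.lookup a i = Poly_Mapping.lookup a' i"
      if "i \<in> insert j S" "a \<in> top A'" "a' \<in> top A'" for i a a'
      using that constA by (auto simp: top_def intro: antisym)
  next
    show "Poly_Mapping.lookup b i = Poly_Mapping.lookup b' i"
      if "i \<in> insert j S" "b \<in> top B'" "b' \<in> top B'" for i b b'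
      using that constB by (auto simp: top_def intro: antisym)
  next
    fix a b a' b'
    assume ab: "a \<in> A" "b \<in> B" "a' \<in> top A'" "b' \<in> top B'" "a + b = a' + b'"
    then have "a' \<in> A'" "b' \<in> B'"
      by (auto simp: top_def)
    with sums ab have mem: "a \<in> A'" "b \<in> B'"
      by blast+
    then have le: "Poly_Mapping.lookup a j \<le> Poly_Mapping.lookup a' j"
      "Poly_Mapping.lookup b j \<le> Poly_Mapping.lookup b' j"
      using ab(3,4) by (auto simp: top_def)
    have "Poly_Mapping.lookup a j + Poly_Mapping.lookup b j =
        Poly_Mapping.lookup a' j + Poly_Mapping.lookup b' j"
      using ab(5) by (metis lookup_add)
    with le have "Poly_Mapping.lookup a j = Poly_Mapping.lookup a' j"
      "Poly_Mapping.lookup b j = Poly_Mapping.lookup b' j" by auto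
    with mem ab(3,4) show "a \<in> top A'" "b \<in> top B'"
      by (auto simp: top_def)
  qed
qed

lemma unique_sum:
  fixes A B :: "'n::finite expo set"
  assumes "finite A" "A \<noteq> {}" "finite B" "B \<noteq> {}"
  obtains a b where "a \<in> A" "b \<in> B"
    "\<And>a' b'. a' \<in> A \<Longrightarrow> b' \<in> B \<Longrightarrow> a' + b' = a + b \<Longrightarrow> a' = a \<and> b' = b"
proof -
  obtain A' B' where sub: "A' \<subseteq> A" "A' \<noteq> {}" "B' \<subseteq> B" "B' \<noteq> {}"
    and constA: "\<forall>i\<in>UNIV. \<forall>a\<in>A'. \<forall>a'\<in>A'. Poly_Mapping.lookup a i = Poly_Mapping.lookup a' i"
    and constB: "\<forall>i\<in>UNIV. \<forall>b\<in>B'. \<forall>b'\<in>B'. Poly_Mapping.lookup b i = Poly_Mapping.lookup b' i"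
    and sums: "\<forall>a\<in>A. \<forall>b\<in>B. \<forall>a'\<in>A'. \<forall>b'\<in>B'. a + b = a' + b' \<longrightarrow> a \<in> A' \<and> b \<in> B'"
    using unique_sum_coordinates[OF finite[of UNIV] assms] by (elim exE conjE)
  obtain a b where ab: "a \<in> A'" "b \<in> B'"
    using sub by blast
  show ?thesis
  proof (rule that)
    show "a \<in> A" "b \<in> B"
      using ab sub by auto
  next
    fix a' b' assume "a' \<in> A" "b' \<in> B" "a' + b' = a + b"
    with sums ab have "a' \<in> A'" "b' \<in> B'"
      by blast+
    with constA constB ab show "a' = a \<and> b' = b"
      by (intro conjI poly_mapping_eqI) blast+
  qed
qed

lemma lookup_mult_unique_sum:
  fixes p q :: "('a::cancel_comm_monoid_add) \<Rightarrow>\<^sub>0 'b::semiring_0"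
  assumes "\<And>a' b'. a' \<in> Poly_Mapping.keys p \<Longrightarrow> b' \<in> Poly_Mapping.keys q \<Longrightarrow>
    a' + b' = a + b \<Longrightarrow> a' = a \<and> b' = b"
  shows "Poly_Mapping.lookup (p * q) (a + b) = Poly_Mapping.lookup p a * Poly_Mapping.lookup q b"
proof -
  have "Poly_Mapping.lookup p l * (\<Sum>k. Poly_Mapping.lookup q k when a + b = l + k) =
      (Poly_Mapping.lookup p a * Poly_Mapping.lookup q b when l = a)" for l
  proof (cases "l \<in> Poly_Mapping.keys p")
    case True
    have "(Poly_Mapping.lookup q k when a + b = l + k) =
        ((Poly_Mapping.lookup q b when l = a) when k = b)" for k
      using assms[OF True, of k] by (auto simp: when_def in_keys_iff eq_commute[of "a + b"])
    then show ?thesis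
      by (simp add: when_def)
  next
    case False
    then show ?thesis by (auto simp: in_keys_iff when_def)
  qed
  then show ?thesis by (simp add: lookup_mult)
qed

definition variable_ideal :: "'n::finite \<Rightarrow> ('n, 'k::{Fields.field}) mpoly set" where
  "variable_ideal i = mono_ideal {Poly_Mapping.single i 1}"

lemma single_expo_dvd_iff: "Poly_Mapping.single i (Suc 0) \<preceq> b \<longleftrightarrow> Poly_Mapping.lookup b i \<noteq> 0"
  by (auto simp: expo_dvd_def lookup_single when_def)

lemma variable_ideal_eq:
  "variable_ideal i = {p. \<forall>b\<in>Poly_Mapping.keys p. Poly_Mapping.lookup b i \<noteq> 0}"
  by (simp add: variable_ideal_def mono_ideal_eq single_expo_dvd_iff)

lemma variable_ideal_eq_multiples:
  "variable_ideal i = range (\<lambda>p. p * mono_of (Poly_Mapping.single i 1))"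
proof -
  interpret cring "mpoly_ring" by (rule cring_from_type_algebra)
  show ?thesis
    using cgenideal_eq_genideal[of "mono_of (Poly_Mapping.single i 1)"]
    by (auto simp: variable_ideal_def mono_ideal_def cgenideal_def ring_of_type_algebra_def)
qed

lemma ideal_variable_ideal: "ideal (variable_ideal i) mpoly_ring"
  unfolding variable_ideal_def by (rule ideal_mono_ideal)

text \<open>
  If neither \<open>p\<close> nor \<open>q\<close> lies in \<open>(x\<^sub>i)\<close>, then among the terms free of \<open>x\<^sub>i\<close> some pair has a unique
  sum of exponents, and the corresponding term of \<open>p q\<close> survives and is free of \<open>x\<^sub>i\<close>.
\<close>

lemma primeideal_variable:
  fixes i :: "'n::finite"
  shows "primeideal (variable_ideal i :: ('n, 'k::{Fields.field}) mpoly set) mpoly_ring"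
proof -
  have "p * q \<notin> variable_ideal i"
    if pq: "p \<notin> variable_ideal i" "q \<notin> variable_ideal i" for p q :: "('n, 'k) mpoly"
  proof -
    define A where "A = {a\<in>Poly_Mapping.keys p. Poly_Mapping.lookup a i = 0}"
    define B where "B = {b\<in>Poly_Mapping.keys q. Poly_Mapping.lookup b i = 0}"
    have "A \<noteq> {}" "B \<noteq> {}" "finite A" "finite B"
      using pq by (auto simp: variable_ideal_eq A_def B_def)
    then obtain a b where ab: "a \<in> A" "b \<in> B"
      and uniq: "\<And>a' b'. a' \<in> A \<Longrightarrow> b' \<in> B \<Longrightarrow> a' + b' = a + b \<Longrightarrow> a' = a \<and> b' = b"
      using unique_sum by metis
    have ab_i: "Poly_Mapping.lookup (a + b) i = 0"
      using ab by (simp add: A_def B_def lookup_add)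
    have "a' = a \<and> b' = b"
      if "a' \<in> Poly_Mapping.keys p" "b' \<in> Poly_Mapping.keys q" "a' + b' = a + b" for a' b'
    proof (rule uniq)
      have "Poly_Mapping.lookup a' i + Poly_Mapping.lookup b' i = 0"
        using ab_i that(3) by (metis lookup_add)
      then show "a' \<in> A" "b' \<in> B"
        using that(1,2) by (auto simp: A_def B_def)
    qed (rule that(3))
    then have "Poly_Mapping.lookup (p * q) (a + b) = Poly_Mapping.lookup p a * Poly_Mapping.lookup q b"
      by (rule lookup_mult_unique_sum)
    also have "\<dots> \<noteq> 0"
      using ab by (simp add: A_def B_def in_keys_iff)
    finally show ?thesis
      using ab_i by (auto simp: variable_ideal_eq in_keys_iff)
  qed
  moreover have "(1 :: ('n, 'k) mpoly) \<notin> variable_ideal i"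
    by (simp add: variable_ideal_eq)
  ultimately show ?thesis
    using ideal_variable_ideal by (auto simp: primeideal_ring_of_type_algebra_iff)
qed

text \<open>
  Let \<open>P\<close> be a prime strictly inside \<open>(x\<^sub>i)\<close>. Then \<open>x\<^sub>i \<notin> P\<close>, so each \<open>f = g x\<^sub>i\<close> in \<open>P\<close> has its
  cofactor \<open>g\<close> in \<open>P\<close> again. Repeating this, \<open>f\<close> is divisible by every power of \<open>x\<^sub>i\<close>, so \<open>f = 0\<close>.
\<close>

lemma primeideal_below_variable:
  fixes P :: "('n::finite, 'k::{Fields.field}) mpoly set"
  assumes P: "primeideal P mpoly_ring" and less: "P \<subset> variable_ideal i"
  shows "P = {0}"
proof -
  let ?x = "mono_of (Poly_Mapping.single i 1) :: ('n, 'k) mpoly"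
  have idl: "ideal P mpoly_ring"
    and prime: "\<And>a b. a * b \<in> P \<Longrightarrow> a \<in> P \<or> b \<in> P"
    using P by (auto simp: primeideal_ring_of_type_algebra_iff)
  have "?x \<notin> P"
  proof
    assume "?x \<in> P"
    then have "variable_ideal i \<subseteq> P"
      using idl by (auto simp: variable_ideal_eq_multiples ideal_ring_of_type_algebra_iff)
    with less show False by blast
  qed
  have divisible: "\<forall>b\<in>Poly_Mapping.keys f. m \<le> Poly_Mapping.lookup b i" if "f \<in> P" for f m
    using that
  proof (induction m arbitrary: f)
    case (Suc m)
    then obtain g where g: "f = g * ?x"
      using less unfolding variable_ideal_eq_multiples by blast
    with Suc.prems \<open>?x \<notin> P\<close> have "g \<in> P"
      using prime by blast
    with Suc.IH have IH: "\<forall>b\<in>Poly_Mapping.keys g. m \<le> Poly_Mapping.lookup b i" by blast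
    show ?case
    proof
      fix b assume "b \<in> Poly_Mapping.keys f"
      then obtain c where "c \<in> Poly_Mapping.keys g" "b = c + Poly_Mapping.single i 1"
        using keys_mult[of g ?x] unfolding g by (auto simp: mono_of_def)
      with IH show "Suc m \<le> Poly_Mapping.lookup b i"
        by (simp add: lookup_add)
    qed
  qed simp
  have "f = 0" if "f \<in> P" for f
  proof -
    have "Poly_Mapping.keys f = {}"
      using divisible[OF that] by (meson all_not_in_conv not_less_eq_eq)
    then show ?thesis
      by (metis poly_mapping_eqI lookup_zero not_in_keys_iff_lookup_eq_zero empty_iff)
  qed
  then show ?thesis
    using idl by (auto simp: ideal_ring_of_type_algebra_iff)
qed

lemma prime_height_variable_le_1:
  "prime_height mpoly_ring (variable_ideal i :: ('n::finite, 'k::{Fields.field}) mpoly set) \<le> 1"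
  unfolding prime_height_def
proof (rule Sup_least, safe)
  fix k and C :: "nat \<Rightarrow> ('n, 'k) mpoly set"
  assume prime: "\<forall>j\<le>k. primeideal (C j) mpoly_ring" and chain: "\<forall>j<k. C j \<subset> C (Suc j)"
    and top: "C k = variable_ideal i"
  show "enat k \<le> 1"
  proof (rule ccontr)
    assume "\<not> enat k \<le> 1"
    then have "1 < k" by (simp add: one_enat_def)
    then obtain l where k: "k = Suc (Suc l)" by (metis One_nat_def less_imp_Suc_add add_Suc)
    \<comment> \<open>The second last ideal of the chain is already \<open>{0}\<close>, and no ideal lies strictly below it.\<close>
    have "C (Suc l) = {0}"
      using prime chain top k by (intro primeideal_below_variable[of _ i]) auto
    moreover have "C l \<subset> C (Suc l)"
      using chain k by simp
    moreover have "0 \<in> C l"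
      using prime k by (simp add: primeideal_ring_of_type_algebra_iff ideal_ring_of_type_algebra_iff)
    ultimately show False by (auto simp: psubset_eq subset_singleton_iff)
  qed
qed

lemma ex_generator_without_variable:
  assumes "ideal_height mpoly_ring (mono_ideal F :: ('n::finite, 'k::{Fields.field}) mpoly set) \<ge> 2"
  shows "\<exists>f\<in>F. Poly_Mapping.lookup f i = 0"
proof (rule ccontr)
  assume "\<not> ?thesis"
  then have "Poly_Mapping.lookup b i \<noteq> 0" if "f \<in> F" "f \<preceq> b" for f b
    using that unfolding expo_dvd_def by (metis le_zero_eq)
  then have "(mono_ideal F :: ('n, 'k) mpoly set) \<subseteq> variable_ideal i"
    unfolding variable_ideal_eq mono_ideal_eq[of F] by blast
  then have "ideal_height mpoly_ring (mono_ideal F :: ('n, 'k) mpoly set) \<le>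
      prime_height mpoly_ring (variable_ideal i :: ('n, 'k) mpoly set)"
    unfolding ideal_height_def using primeideal_variable by (intro Inf_lower) blast
  also have "\<dots> \<le> 1"
    by (rule prime_height_variable_le_1)
  finally have "(2::enat) \<le> 1"
    using assms order_trans by blast
  then show False by (simp add: one_enat_def numeral_eq_enat)
qed


section \<open>Dualizing twice\<close>

lemma lookup_le_lcm_expo:
  fixes F :: "'n::finite expo set"
  assumes "finite F" "f \<in> F"
  shows "Poly_Mapping.lookup f i \<le> Poly_Mapping.lookup (lcm_expo F) i"
  unfolding lookup_lcm_expo using assms by (intro cSup_upper) auto

lemma lookup_lcm_expo_eqI:
  fixes F :: "'n::finite expo set"
  assumes "f \<in> F" "\<And>g. g \<in> F \<Longrightarrow> Poly_Mapping.lookup g i \<le> Poly_Mapping.lookup f i"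
  shows "Poly_Mapping.lookup (lcm_expo F) i = Poly_Mapping.lookup f i"
  unfolding lookup_lcm_expo using assms by (intro cSup_eq_maximum) auto

text \<open>
  Subtraction of exponents is truncated, so \<open>m - f \<preceq> m - g\<close> gives \<open>g \<preceq> f\<close> only because \<open>g\<close>
  divides \<open>m\<close>; the finiteness of \<open>F\<close> makes \<open>m\<close> a common multiple.
\<close>

lemma antichain_lcm_complement:
  fixes F :: "'n::finite expo set"
  assumes "antichain F" "finite F"
  shows "antichain ((-) (lcm_expo F) ` F)"
proof -
  have "f = g" if "f \<in> F" "g \<in> F" "lcm_expo F - f \<preceq> lcm_expo F - g" for f g
  proof -
    have "Poly_Mapping.lookup g i \<le> Poly_Mapping.lookup f i" for i
    proof -
      have "Poly_Mapping.lookup (lcm_expo F - f) i \<le> Poly_Mapping.lookup (lcm_expo F - g) i"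
        using that(3) by (simp add: expo_dvd_def)
      then show ?thesis
        using lookup_le_lcm_expo[OF assms(2) that(2), of i]
        unfolding lookup_minus by linarith
    qed
    then have "g \<preceq> f" by (simp add: expo_dvd_def)
    with assms(1) that show ?thesis by (auto simp: antichain_def)
  qed
  then show ?thesis by (auto simp: antichain_def)
qed

text \<open>
  In coordinate \<open>i\<close> the maximum of \<open>m\<^sub>i - f\<^sub>i\<close> is \<open>m\<^sub>i\<close>, attained at an \<open>f\<close> not involving \<open>x\<^sub>i\<close>.
\<close>

lemma lcm_expo_lcm_complement:
  fixes F :: "'n::finite expo set"
  assumes gcd_1: "\<And>i. \<exists>f\<in>F. Poly_Mapping.lookup f i = 0"
  shows "lcm_expo ((-) (lcm_expo F) ` F) = lcm_expo F"
proof (rule poly_mapping_eqI)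
  fix i
  obtain f where f: "f \<in> F" "Poly_Mapping.lookup f i = 0"
    using gcd_1 by blast
  have "Poly_Mapping.lookup (lcm_expo ((-) (lcm_expo F) ` F)) i =
      Poly_Mapping.lookup (lcm_expo F - f) i"
    using f by (intro lookup_lcm_expo_eqI) (auto simp: lookup_minus)
  with f show "Poly_Mapping.lookup (lcm_expo ((-) (lcm_expo F) ` F)) i =
      Poly_Mapping.lookup (lcm_expo F) i"
    by (simp add: lookup_minus)
qed

lemma lcm_complement_involution:
  fixes F :: "'n::finite expo set"
  assumes "finite F"
  shows "(-) (lcm_expo F) ` (-) (lcm_expo F) ` F = F"
proof -
  have "lcm_expo F - (lcm_expo F - f) = f" if "f \<in> F" for f
    by (rule poly_mapping_eqI) (simp add: lookup_minus lookup_le_lcm_expo[OF assms that])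
  then show ?thesis by (simp add: image_image)
qed

lemma lcm_dual_antichain:
  assumes "antichain F"
  shows "lcm_dual (mono_ideal F) = mono_ideal ((-) (lcm_expo F) ` F)"
  by (simp add: lcm_dual_def min_mono_gens_antichain[OF assms])

theorem lemma2p3:
  fixes I :: "('n::finite, 'k::{Fields.field}) mpoly set"
  assumes "monomial_ideal I"
    and "ideal_height mpoly_ring I \<ge> 2"
  shows "lcm_dual (lcm_dual I) = I"
proof -
  obtain F where F: "antichain F" and I: "I = mono_ideal F"
    using monomial_ideal_antichain[OF assms(1)] .
  have fin: "finite F"
    using F by (rule finite_antichain)
  have gcd_1: "\<exists>f\<in>F. Poly_Mapping.lookup f i = 0" for i
    using assms(2) unfolding I by (rule ex_generator_without_variable)
  have "lcm_dual (lcm_dual I) =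
      mono_ideal ((-) (lcm_expo ((-) (lcm_expo F) ` F)) ` (-) (lcm_expo F) ` F)"
    unfolding I lcm_dual_antichain[OF F]
    by (rule lcm_dual_antichain[OF antichain_lcm_complement[OF F fin]])
  also have "\<dots> = I"
    unfolding lcm_expo_lcm_complement[OF gcd_1] lcm_complement_involution[OF fin] I ..
  finally show ?thesis .
qed

end
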